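(* Let $R>0$, $Q,K,V\in\mathbb R^{k\times d}$ and $A:=K^\top Q/\sqrt k$. The mean-field self-attention map $F$ with parameters $(A,V)$ is $W_2$-Lipschitz continuous on $\mathcal P(B_R)$, and $$\mathrm{Lip}^{W_2}\big(F_{|\mathcal P(B_R)}\big)\le\|V\|_2\,(1+3\|A\|_2R^2)\,e^{2\|A\|_2R^2}.$$
   Context: $\mathcal P(B_R)$ is the set of Borel probability measures supported in the closed ball $B_R\subset\mathbb R^d$ of center $0$ and radius $R$. Mean-field self-attention with parameters $(A,V)$ maps a compactly supported probability measure $\mu$ on $\mathbb R^d$ to $F(\mu):=(\Gamma_\mu)_\sharp\mu$, where $\Gamma_\mu(x)=\dfrac{\int\exp(x^\top A^\top y)\,Vy\,d\mu(y)}{\int\exp(x^\top A^\top y)\,d\mu(y)}$ and $\varphi_\sharp\mu$ denotes the pushforward ($\varphi_\sharp\mu(B)=\mu(\varphi^{-1}(B))$). $W_2(\mu,\nu)=\big(\inf_{\pi\in\Pi(\mu,\nu)}\int|x-y|^2d\pi(x,y)\big)^{1/2}$ is the 2-Wasserstein distance, $\Pi(\mu,\nu)$ being the set of couplings. $\mathrm{Lip}^{W_2}(F_{|\mathcal X})=\sup_{\mu\ne\nu\in\mathcal X}W_2(F(\mu),F(\nu))/W_2(\mu,\nu)$. $\|\cdot\|_2$ is the spectral norm. *)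

theory Defs
  imports "HOL-Analysis.Analysis" "HOL-Probability.Probability"
begin

text \<open>Borel probability measures supported in the closed ball of center 0 and radius R.\<close>
definition prob_ball :: "real \<Rightarrow> ('a::euclidean_space) measure set" where
  "prob_ball R = {\<mu>. prob_space \<mu> \<and> sets \<mu> = sets borel \<and> emeasure \<mu> (UNIV - cball 0 R) = 0}"

text \<open>Couplings of two Borel measures.\<close>
definition couplings :: "('a::euclidean_space) measure \<Rightarrow> ('b::euclidean_space) measure \<Rightarrow> ('a \<times> 'b) measure set" where
  "couplings \<mu> \<nu> = {\<pi>. prob_space \<pi> \<and> sets \<pi> = sets (borel \<Otimes>\<^sub>M borel)
                       \<and> distr \<pi> borel fst = \<mu> \<and> distr \<pi> borel snd = \<nu>}"

text \<open>2-Wasserstein distance.\<close>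
definition W2 :: "('a::euclidean_space) measure \<Rightarrow> 'a measure \<Rightarrow> real" where
  "W2 \<mu> \<nu> = sqrt (enn2real (INF \<pi>\<in>couplings \<mu> \<nu>. \<integral>\<^sup>+ p. ennreal ((dist (fst p) (snd p))\<^sup>2) \<partial>\<pi>))"

text \<open>The map \<Gamma>_\<mu> of mean-field self-attention with parameters (A,V).\<close>
definition Gamma :: "real^'d^'d \<Rightarrow> real^'d^'k \<Rightarrow> (real^'d) measure \<Rightarrow> real^'d \<Rightarrow> real^'k" where
  "Gamma A V \<mu> x =
     (1 / (\<integral>y. exp ((A *v x) \<bullet> y) \<partial>\<mu>)) *\<^sub>R (\<integral>y. exp ((A *v x) \<bullet> y) *\<^sub>R (V *v y) \<partial>\<mu>)"

text \<open>Mean-field self-attention F(\<mu>) = (\<Gamma>_\<mu>)_# \<mu>.\<close>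
definition SA :: "real^'d^'d \<Rightarrow> real^'d^'k \<Rightarrow> (real^'d) measure \<Rightarrow> (real^'k) measure" where
  "SA A V \<mu> = distr \<mu> borel (Gamma A V \<mu>)"

end

theory Submission
  imports Defs
begin

text \<open>
  Write \<open>\<Gamma>\<^sub>\<mu>(x) = V m\<^sub>\<mu>(A x)\<close>, where \<open>m\<^sub>\<mu>(u)\<close> is the barycentre of the exponentially
  tilted measure \<open>e\<^bsup>u\<cdot>z\<^esup> \<mu>(dz)\<close>. On the ball \<open>B\<^sub>R\<close> every tilt \<open>e\<^bsup>u\<cdot>z\<^esup>\<close> lies between
  \<open>e\<^bsup>-|u|R\<^esup>\<close> and \<open>e\<^bsup>|u|R\<^esup>\<close>. Changing the tilt moves the barycentre by at most the tilted
  variance (\<open>\<le> R\<^sup>2\<close>) times \<open>|\<Delta>u|\<close>, up to such exponential factors; changing \<open>\<mu>\<close> to \<open>\<nu>\<close>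
  along a coupling \<open>\<pi>\<close> changes the numerator and denominator of \<open>m\<close> by
  \<open>O(\<integral>|z - w| d\<pi>)\<close>. Hence, with \<open>t = \<parallel>A\<parallel>R\<^sup>2\<close>,
  \<open>|\<Gamma>\<^sub>\<mu>(x) - \<Gamma>\<^sub>\<nu>(y)| \<le> \<parallel>V\<parallel> e\<^bsup>2t\<^esup> (t |x - y| + (1 + 2t) \<integral>|z - w| d\<pi>)\<close> on \<open>B\<^sub>R\<close>.
  Pushing \<open>\<pi>\<close> forward by \<open>\<Gamma>\<^sub>\<mu> \<times> \<Gamma>\<^sub>\<nu>\<close> gives a coupling of \<open>F(\<mu>)\<close> and \<open>F(\<nu>)\<close>, and by Jensen's
  inequality its quadratic cost is at most \<open>(\<parallel>V\<parallel> e\<^bsup>2t\<^esup> (1 + 3t))\<^sup>2\<close> times that of \<open>\<pi>\<close>.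
\<close>

lemma abs_exp_diff_le:
  fixes s t :: real
  shows "\<bar>exp s - exp t\<bar> \<le> max (exp s) (exp t) * \<bar>s - t\<bar>"
proof -
  have "exp t - exp s \<le> exp t * (t - s)" for s t :: real
    using exp_ge_add_one_self[of "s - t"] by (simp add: exp_diff field_simps)
  from this[of s t] this[of t s] show ?thesis
    by (cases "s \<le> t") (auto simp: abs_if max_def algebra_simps intro: order.trans)
qed

lemma abs_inner_le_mult_radius:
  fixes u z :: "'a::real_inner"
  assumes "norm z \<le> R"
  shows "\<bar>u \<bullet> z\<bar> \<le> norm u * R"
  using Cauchy_Schwarz_ineq2[of u z] mult_left_mono[OF assms norm_ge_zero[of u]] by linarith

lemma exp_inner_le:
  fixes u z :: "'a::real_inner"
  shows "norm z \<le> R \<Longrightarrow> exp (u \<bullet> z) \<le> exp (norm u * R)"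
  using abs_inner_le_mult_radius[of z R u] by simp

lemma exp_inner_ge:
  fixes u z :: "'a::real_inner"
  shows "norm z \<le> R \<Longrightarrow> exp (- (norm u * R)) \<le> exp (u \<bullet> z)"
  using abs_inner_le_mult_radius[of z R u] by simp

lemma abs_exp_inner_diff_le:
  fixes u z w :: "'a::real_inner"
  assumes "norm z \<le> R" "norm w \<le> R"
  shows "\<bar>exp (u \<bullet> z) - exp (u \<bullet> w)\<bar> \<le> exp (norm u * R) * (norm u * norm (z - w))"
proof -
  have "\<bar>exp (u \<bullet> z) - exp (u \<bullet> w)\<bar> \<le> max (exp (u \<bullet> z)) (exp (u \<bullet> w)) * \<bar>u \<bullet> (z - w)\<bar>"
    using abs_exp_diff_le by (simp add: inner_diff_right)
  also have "\<dots> \<le> exp (norm u * R) * (norm u * norm (z - w))"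
    using assms exp_inner_le Cauchy_Schwarz_ineq2[of u "z - w"] by (intro mult_mono) auto
  finally show ?thesis .
qed

lemma norm_integral_le_integral_AE:
  fixes f :: "'a \<Rightarrow> 'b::{banach,second_countable_topology}"
  assumes "integrable M f" "integrable M g" "AE x in M. norm (f x) \<le> g x"
  shows "norm (\<integral>x. f x \<partial>M) \<le> (\<integral>x. g x \<partial>M)"
  using assms by (intro order_trans[OF integral_norm_bound integral_mono_AE]) auto

locale ball_prob_space = prob_space M for M :: "'a::euclidean_space measure" +
  fixes R :: real
  assumes sets_eq_borel: "sets M = sets borel"
    and AE_norm_le: "AE z in M. norm z \<le> R"
begin

lemma radius_nonneg: "0 \<le> R"
proof -
  have "AE z in M. 0 \<le> R" using AE_norm_le by eventually_elim (use norm_ge_zero order_trans in blast)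
  then show ?thesis by simp
qed

lemma integrable_continuous:
  fixes f :: "'a \<Rightarrow> 'b::{banach,second_countable_topology}"
  assumes "continuous_on UNIV f"
  shows "integrable M f"
proof -
  obtain B where B: "\<And>z. z \<in> cball 0 R \<Longrightarrow> norm (f z) \<le> B"
    using compact_imp_bounded[OF compact_continuous_image[OF continuous_on_subset[OF assms] compact_cball]]
    by (meson bounded_iff imageI subset_UNIV)
  show ?thesis
  proof (rule integrable_const_bound)
    show "AE x in M. norm (f x) \<le> B" using AE_norm_le by eventually_elim (auto intro: B)
    show "f \<in> borel_measurable M"
      using measurable_cong_sets[OF sets_eq_borel refl] borel_measurable_continuous_onI[OF assms]
      by blast
  qed
qed

end

lemma ball_prob_space_if_prob_ball: "\<mu> \<in> prob_ball R \<Longrightarrow> ball_prob_space \<mu> R"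
proof -
  assume "\<mu> \<in> prob_ball R"
  then have p: "prob_space \<mu>" and s: "sets \<mu> = sets borel"
    and e: "emeasure \<mu> (UNIV - cball 0 R) = 0"
    unfolding prob_ball_def by auto
  interpret prob_space \<mu> by (rule p)
  have "UNIV - cball 0 R \<in> null_sets \<mu>"
    using e s by (simp add: null_sets_def borel_open open_Diff)
  then have "AE z in \<mu>. norm z \<le> R" by (rule AE_I') auto
  with s show ?thesis by unfold_locales
qed

definition tilted_mass :: "'a::euclidean_space measure \<Rightarrow> 'a \<Rightarrow> real" where
  "tilted_mass M u = (\<integral>z. exp (u \<bullet> z) \<partial>M)"

text \<open>\<open>tilted_mean M u\<close> is the barycentre of \<open>e\<^bsup>u\<cdot>z\<^esup> M(dz)\<close>; the self-attention map is
  \<open>Gamma A V M x = V *v tilted_mean M (A *v x)\<close> (lemma \<open>Gamma_eq_tilted_mean\<close>).\<close>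

definition tilted_mean :: "'a::euclidean_space measure \<Rightarrow> 'a \<Rightarrow> 'a" where
  "tilted_mean M u = (1 / tilted_mass M u) *\<^sub>R (\<integral>z. exp (u \<bullet> z) *\<^sub>R z \<partial>M)"

context ball_prob_space
begin

lemma integrable_exp_inner: "integrable M (\<lambda>z. exp (u \<bullet> z))"
  by (intro integrable_continuous continuous_intros)

lemma integrable_exp_inner_scaleR: "integrable M (\<lambda>z. exp (u \<bullet> z) *\<^sub>R z)"
  by (intro integrable_continuous continuous_intros)

lemma tilted_mass_add_ge: "exp (- (norm w * R)) * tilted_mass M u \<le> tilted_mass M (u + w)"
proof -
  have "(\<integral>z. exp (- (norm w * R)) * exp (u \<bullet> z) \<partial>M) \<le> (\<integral>z. exp ((u + w) \<bullet> z) \<partial>M)"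
  proof (rule integral_mono_AE)
    show "AE z in M. exp (- (norm w * R)) * exp (u \<bullet> z) \<le> exp ((u + w) \<bullet> z)"
      using AE_norm_le by eventually_elim
        (use exp_inner_ge[of _ R w] in \<open>simp add: inner_add_left exp_add mult.commute\<close>)
  qed (auto intro: integrable_exp_inner)
  then show ?thesis unfolding tilted_mass_def by simp
qed

lemma tilted_mass_ge: "exp (- (norm u * R)) \<le> tilted_mass M u"
  using tilted_mass_add_ge[of u 0] by (simp add: tilted_mass_def prob_space)

lemma tilted_mass_pos: "0 < tilted_mass M u"
  using tilted_mass_ge[of u] by (meson exp_gt_zero less_le_trans)

lemma integral_exp_inner_scaleR: "(\<integral>z. exp (u \<bullet> z) *\<^sub>R z \<partial>M) = tilted_mass M u *\<^sub>R tilted_mean M u"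
  using tilted_mass_pos[of u] by (simp add: tilted_mean_def)

lemma norm_tilted_mean_le: "norm (tilted_mean M u) \<le> R"
proof -
  have "norm (\<integral>z. exp (u \<bullet> z) *\<^sub>R z \<partial>M) \<le> (\<integral>z. norm (exp (u \<bullet> z) *\<^sub>R z) \<partial>M)"
    by (rule integral_norm_bound)
  also have "\<dots> \<le> (\<integral>z. R * exp (u \<bullet> z) \<partial>M)"
    by (rule integral_mono_AE)
      (use AE_norm_le integrable_exp_inner integrable_norm[OF integrable_exp_inner_scaleR] in
        \<open>auto simp: mult.commute elim!: eventually_mono\<close>)
  finally have "tilted_mass M u * norm (tilted_mean M u) \<le> tilted_mass M u * R"
    using tilted_mass_pos[of u]
    by (simp add: integral_exp_inner_scaleR tilted_mass_def mult.commute)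
  then show ?thesis using tilted_mass_pos[of u] by simp
qed

lemma tilted_variance_le:
  "(\<integral>z. exp (u \<bullet> z) * (norm (z - tilted_mean M u))\<^sup>2 \<partial>M) \<le> tilted_mass M u * R\<^sup>2"
proof -
  define m where "m = tilted_mean M u"
  have integrable: "integrable M (\<lambda>z. exp (u \<bullet> z) * (norm z)\<^sup>2)"
    by (intro integrable_continuous continuous_intros)
  have first_moment: "(\<integral>z. exp (u \<bullet> z) * (z \<bullet> m) \<partial>M) = (\<integral>z. exp (u \<bullet> z) *\<^sub>R z \<partial>M) \<bullet> m"
    using integral_inner_left[of m M "\<lambda>z. exp (u \<bullet> z) *\<^sub>R z"] integrable_exp_inner_scaleR[of u]
    by simp
  have "(\<integral>z. exp (u \<bullet> z) * (norm (z - m))\<^sup>2 \<partial>M)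
      = (\<integral>z. exp (u \<bullet> z) * (norm z)\<^sup>2 - 2 * (exp (u \<bullet> z) * (z \<bullet> m))
           + exp (u \<bullet> z) * (norm m)\<^sup>2 \<partial>M)"
    by (simp add: power2_norm_eq_inner inner_diff_left inner_diff_right inner_commute algebra_simps)
  also have "\<dots> = (\<integral>z. exp (u \<bullet> z) * (norm z)\<^sup>2 \<partial>M)
      - 2 * (\<integral>z. exp (u \<bullet> z) * (z \<bullet> m) \<partial>M) + tilted_mass M u * (norm m)\<^sup>2"
    using integrable integrable_exp_inner integrable_continuous[of "\<lambda>z. exp (u \<bullet> z) * (z \<bullet> m)"]
    by (simp add: integral_add integral_diff continuous_intros tilted_mass_def)
  also have "\<dots> = (\<integral>z. exp (u \<bullet> z) * (norm z)\<^sup>2 \<partial>M) - tilted_mass M u * (norm m)\<^sup>2"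
    unfolding first_moment integral_exp_inner_scaleR by (simp add: m_def power2_norm_eq_inner)
  also have "\<dots> \<le> (\<integral>z. exp (u \<bullet> z) * R\<^sup>2 \<partial>M)"
  proof -
    have "(\<integral>z. exp (u \<bullet> z) * (norm z)\<^sup>2 \<partial>M) \<le> (\<integral>z. exp (u \<bullet> z) * R\<^sup>2 \<partial>M)"
      by (rule integral_mono_AE)
        (use AE_norm_le integrable integrable_exp_inner in
          \<open>auto elim!: eventually_mono intro!: mult_left_mono power_mono\<close>)
    moreover have "0 \<le> tilted_mass M u * (norm m)\<^sup>2" using tilted_mass_pos[of u] by simp
    ultimately show ?thesis by linarith
  qed
  finally show ?thesis by (simp add: m_def tilted_mass_def)
qed

lemma tilted_mean_add_eq_integral:
  fixes u w :: 'a
  defines "m \<equiv> tilted_mean M u"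
  shows "tilted_mass M (u + w) *\<^sub>R (tilted_mean M (u + w) - m)
    = (\<integral>z. exp (u \<bullet> z) *\<^sub>R ((exp (w \<bullet> z) - exp (w \<bullet> m)) *\<^sub>R (z - m)) \<partial>M)"
proof -
  have "(\<integral>z. exp (u \<bullet> z) *\<^sub>R ((exp (w \<bullet> z) - exp (w \<bullet> m)) *\<^sub>R (z - m)) \<partial>M)
      = (\<integral>z. (exp ((u + w) \<bullet> z) *\<^sub>R z - exp ((u + w) \<bullet> z) *\<^sub>R m)
           - exp (w \<bullet> m) *\<^sub>R (exp (u \<bullet> z) *\<^sub>R z - exp (u \<bullet> z) *\<^sub>R m) \<partial>M)"
    by (simp add: inner_add_left exp_add algebra_simps)
  also have "\<dots> = (tilted_mass M (u + w) *\<^sub>R tilted_mean M (u + w) - tilted_mass M (u + w) *\<^sub>R m)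
      - exp (w \<bullet> m) *\<^sub>R (tilted_mass M u *\<^sub>R m - tilted_mass M u *\<^sub>R m)"
    using integrable_exp_inner integrable_exp_inner_scaleR
    by (simp add: integral_diff integral_scaleR_left integral_exp_inner_scaleR m_def
        flip: tilted_mass_def)
  finally show ?thesis by (simp add: m_def algebra_simps)
qed

lemma norm_tilted_mean_add_le:
  "norm (tilted_mean M (u + w) - tilted_mean M u) \<le> exp (2 * norm w * R) * norm w * R\<^sup>2"
proof -
  define m where "m = tilted_mean M u"
  define E where "E = exp (norm w * R)"
  have E_ge: "tilted_mass M u \<le> E * tilted_mass M (u + w)"
    using tilted_mass_add_ge[of w u] by (simp add: E_def exp_minus field_simps)
  have pointwise: "AE z in M. norm (exp (u \<bullet> z) *\<^sub>R ((exp (w \<bullet> z) - exp (w \<bullet> m)) *\<^sub>R (z - m)))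
      \<le> E * norm w * (exp (u \<bullet> z) * (norm (z - m))\<^sup>2)"
    using AE_norm_le
  proof eventually_elim
    case (elim z)
    have "\<bar>exp (w \<bullet> z) - exp (w \<bullet> m)\<bar> \<le> E * (norm w * norm (z - m))"
      unfolding E_def m_def using elim norm_tilted_mean_le by (intro abs_exp_inner_diff_le)
    then have "exp (u \<bullet> z) * (\<bar>exp (w \<bullet> z) - exp (w \<bullet> m)\<bar> * norm (z - m))
        \<le> exp (u \<bullet> z) * (E * (norm w * norm (z - m)) * norm (z - m))"
      by (intro mult_left_mono mult_right_mono) auto
    then show ?case by (simp add: abs_mult power2_eq_square mult_ac)
  qed
  have "tilted_mass M (u + w) * norm (tilted_mean M (u + w) - m)
      = norm (tilted_mass M (u + w) *\<^sub>R (tilted_mean M (u + w) - m))"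
    using tilted_mass_pos[of "u + w"] by simp
  also have "\<dots> = norm (\<integral>z. exp (u \<bullet> z) *\<^sub>R ((exp (w \<bullet> z) - exp (w \<bullet> m)) *\<^sub>R (z - m)) \<partial>M)"
    unfolding m_def by (rule arg_cong[OF tilted_mean_add_eq_integral])
  also have "\<dots> \<le> (\<integral>z. E * norm w * (exp (u \<bullet> z) * (norm (z - m))\<^sup>2) \<partial>M)"
    by (rule norm_integral_le_integral_AE[OF _ _ pointwise])
      (intro integrable_continuous continuous_intros)+
  also have "\<dots> \<le> E * norm w * (tilted_mass M u * R\<^sup>2)"
    using tilted_variance_le[of u] radius_nonneg by (simp add: m_def E_def mult_left_mono)
  also have "\<dots> \<le> E * norm w * (E * tilted_mass M (u + w) * R\<^sup>2)"
    using E_ge by (simp add: E_def mult_left_mono mult_right_mono)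
  also have "\<dots> = tilted_mass M (u + w) * (exp (2 * norm w * R) * norm w * R\<^sup>2)"
    by (simp add: E_def mult_exp_exp)
  finally show ?thesis using tilted_mass_pos[of "u + w"] by (simp add: m_def)
qed

text \<open>Going through the midpoint halves the exponent of \<open>norm_tilted_mean_add_le\<close>; this is what
  produces the factor \<open>exp (2 \<parallel>A\<parallel> R\<^sup>2)\<close> rather than \<open>exp (4 \<parallel>A\<parallel> R\<^sup>2)\<close>.\<close>

lemma norm_tilted_mean_diff_le:
  assumes "norm (u - v) \<le> 2 * r"
  shows "norm (tilted_mean M u - tilted_mean M v) \<le> exp (2 * r * R) * R\<^sup>2 * norm (u - v)"
proof -
  define h where "h = (1 / 2) *\<^sub>R (u - v)"
  have "h + h = u - v" by (simp add: h_def flip: scaleR_add_left)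
  then have u_eq: "u = (v + h) + h" by (simp add: algebra_simps)
  have norm_h: "norm h = norm (u - v) / 2" unfolding h_def norm_scaleR by simp
  have "norm (tilted_mean M u - tilted_mean M v)
      \<le> norm (tilted_mean M ((v + h) + h) - tilted_mean M (v + h))
        + norm (tilted_mean M (v + h) - tilted_mean M v)"
    unfolding u_eq
    using norm_triangle_ineq[of "tilted_mean M (v + h + h) - tilted_mean M (v + h)"
        "tilted_mean M (v + h) - tilted_mean M v"] by simp
  also have "\<dots> \<le> exp (2 * norm h * R) * norm h * R\<^sup>2 + exp (2 * norm h * R) * norm h * R\<^sup>2"
    by (intro add_mono norm_tilted_mean_add_le)
  also have "\<dots> = exp (norm (u - v) * R) * R\<^sup>2 * norm (u - v)"
    unfolding norm_h by (simp add: field_simps)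
  also have "\<dots> \<le> exp (2 * r * R) * R\<^sup>2 * norm (u - v)"
  proof -
    have "norm (u - v) * R \<le> 2 * r * R" using assms radius_nonneg by (rule mult_right_mono)
    then show ?thesis by (intro mult_right_mono) auto
  qed
  finally show ?thesis .
qed

lemma continuous_on_tilted_mean: "continuous_on UNIV (tilted_mean M)"
proof (intro continuous_at_imp_continuous_on ballI)
  fix u :: 'a
  define g where "g v = exp (2 * norm (v - u) * R) * norm (v - u) * R\<^sup>2" for v
  have "isCont g u" unfolding g_def by (intro continuous_intros)
  then have g_tendsto: "(g \<longlongrightarrow> 0) (at u)" by (simp add: isCont_def g_def)
  have bound: "norm (tilted_mean M v - tilted_mean M u) \<le> g v" for v
    using norm_tilted_mean_add_le[of u "v - u"] unfolding g_def by simp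
  have "((\<lambda>v. tilted_mean M v - tilted_mean M u) \<longlongrightarrow> 0) (at u)"
    by (rule Lim_null_comparison[OF always_eventually[OF allI[OF bound]] g_tendsto])
  then show "isCont (tilted_mean M) u" by (simp add: LIM_zero_iff isCont_def)
qed

end

lemma Gamma_eq_tilted_mean:
  assumes "ball_prob_space M R"
  shows "Gamma A V M x = V *v tilted_mean M (A *v x)"
proof -
  interpret ball_prob_space M R by (fact assms)
  have "(\<integral>y. exp ((A *v x) \<bullet> y) *\<^sub>R (V *v y) \<partial>M) = V *v (\<integral>y. exp ((A *v x) \<bullet> y) *\<^sub>R y \<partial>M)"
    using integral_bounded_linear[OF matrix_vector_mul_bounded_linear integrable_exp_inner_scaleR]
    by (simp add: matrix_vector_mult_scaleR)
  then show ?thesis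
    by (simp add: Gamma_def tilted_mean_def tilted_mass_def matrix_vector_mult_scaleR)
qed

lemma continuous_on_Gamma:
  assumes "ball_prob_space M R"
  shows "continuous_on UNIV (Gamma A V M)"
proof -
  have "continuous_on UNIV ((*v) V \<circ> tilted_mean M \<circ> (*v) A)"
    using ball_prob_space.continuous_on_tilted_mean[OF assms]
    by (intro continuous_on_compose matrix_vector_mult_linear_continuous_on)
      (auto intro: continuous_on_subset)
  then show ?thesis by (simp add: Gamma_eq_tilted_mean[OF assms] comp_def)
qed

lemma norm_tilted_mean_matrix_diff_le:
  fixes A :: "real^'n^'m" and M :: "(real^'m) measure"
  assumes "ball_prob_space M R" "norm x \<le> R" "norm y \<le> R"
  shows "norm (tilted_mean M (A *v x) - tilted_mean M (A *v y))
    \<le> exp (2 * onorm ((*v) A) * R\<^sup>2) * (onorm ((*v) A) * R\<^sup>2) * dist x y"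
proof -
  define a where "a = onorm ((*v) A)"
  have a_nonneg: "0 \<le> a" unfolding a_def by (rule onorm_pos_le[OF matrix_vector_mul_bounded_linear])
  have Lipschitz: "norm (A *v x - A *v y) \<le> a * dist x y"
    using onorm[OF matrix_vector_mul_bounded_linear, of A "x - y"]
    by (simp add: a_def dist_norm matrix_vector_mult_diff_distrib)
  have "dist x y \<le> 2 * R"
    using dist_triangle2[of x y 0] assms(2,3) by simp
  then have "a * dist x y \<le> 2 * (a * R)"
    using mult_left_mono[OF _ a_nonneg] by fastforce
  with Lipschitz have "norm (tilted_mean M (A *v x) - tilted_mean M (A *v y))
      \<le> exp (2 * (a * R) * R) * R\<^sup>2 * norm (A *v x - A *v y)"
    by (intro ball_prob_space.norm_tilted_mean_diff_le[OF assms(1)]) simp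
  also have "\<dots> \<le> exp (2 * (a * R) * R) * R\<^sup>2 * (a * dist x y)"
    using Lipschitz by (intro mult_left_mono) auto
  also have "\<dots> = exp (2 * a * R\<^sup>2) * (a * R\<^sup>2) * dist x y"
    by (simp add: power2_eq_square mult_ac)
  finally show ?thesis unfolding a_def .
qed

locale ball_coupling = M1: ball_prob_space \<mu> R + M2: ball_prob_space \<nu> R
  for \<mu> \<nu> :: "'a::euclidean_space measure" and R +
  fixes \<pi> :: "('a \<times> 'a) measure"
  assumes coupling: "\<pi> \<in> couplings \<mu> \<nu>"
begin

lemma sets_coupling_pair: "sets \<pi> = sets (borel \<Otimes>\<^sub>M borel)"
  using coupling by (simp add: couplings_def)

lemma sets_coupling: "sets \<pi> = sets borel"
  using sets_coupling_pair borel_prod[where 'a='a and 'b='a] by metis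

lemma measurable_fst_coupling: "fst \<in> measurable \<pi> borel"
  using measurable_cong_sets[OF sets_coupling_pair refl] measurable_fst by blast

lemma measurable_snd_coupling: "snd \<in> measurable \<pi> borel"
  using measurable_cong_sets[OF sets_coupling_pair refl] measurable_snd by blast

lemma distr_fst_coupling: "distr \<pi> borel fst = \<mu>"
  using coupling by (simp add: couplings_def)

lemma distr_snd_coupling: "distr \<pi> borel snd = \<nu>"
  using coupling by (simp add: couplings_def)

lemma AE_norm_fst_le: "AE p in \<pi>. norm (fst p) \<le> R"
proof -
  have "AE z in distr \<pi> borel fst. norm z \<le> R"
    unfolding distr_fst_coupling by (fact M1.AE_norm_le)
  then show ?thesis by (subst (asm) AE_distr_iff) (auto intro: measurable_fst_coupling)
qed

lemma AE_norm_snd_le: "AE p in \<pi>. norm (snd p) \<le> R"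
proof -
  have "AE z in distr \<pi> borel snd. norm z \<le> R"
    unfolding distr_snd_coupling by (fact M2.AE_norm_le)
  then show ?thesis by (subst (asm) AE_distr_iff) (auto intro: measurable_snd_coupling)
qed

lemma integral_fst_coupling:
  fixes h :: "'a \<Rightarrow> 'b::{banach,second_countable_topology}"
  shows "h \<in> borel_measurable borel \<Longrightarrow> (\<integral>z. h z \<partial>\<mu>) = (\<integral>p. h (fst p) \<partial>\<pi>)"
  using integral_distr[OF measurable_fst_coupling, of h] by (simp add: distr_fst_coupling)

lemma integral_snd_coupling:
  fixes h :: "'a \<Rightarrow> 'b::{banach,second_countable_topology}"
  shows "h \<in> borel_measurable borel \<Longrightarrow> (\<integral>z. h z \<partial>\<nu>) = (\<integral>p. h (snd p) \<partial>\<pi>)"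
  using integral_distr[OF measurable_snd_coupling, of h] by (simp add: distr_snd_coupling)

end

sublocale ball_coupling \<subseteq> P: ball_prob_space \<pi> "2 * R"
proof -
  have "prob_space \<pi>" using coupling by (simp add: couplings_def)
  moreover have "AE p in \<pi>. norm p \<le> 2 * R"
    using AE_norm_fst_le AE_norm_snd_le
    by eventually_elim (metis norm_Pair_le prod.collapse add_mono mult_2 order_trans)
  ultimately show "ball_prob_space \<pi> (2 * R)"
    using sets_coupling by (simp add: ball_prob_space_def ball_prob_space_axioms_def)
qed

context ball_coupling
begin

lemma norm_integral_le_mean_dist:
  fixes f :: "'a \<times> 'a \<Rightarrow> 'b::{banach,second_countable_topology}"
  assumes "integrable \<pi> f" "AE p in \<pi>. norm (f p) \<le> C * dist (fst p) (snd p)"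
  shows "norm (\<integral>p. f p \<partial>\<pi>) \<le> C * (\<integral>p. dist (fst p) (snd p) \<partial>\<pi>)"
proof -
  have "integrable \<pi> (\<lambda>p. C * dist (fst p) (snd p))"
    by (intro integrable_mult_right P.integrable_continuous continuous_intros)
  from norm_integral_le_integral_AE[OF assms(1) this assms(2)] show ?thesis by simp
qed

lemma integrable_coupling_continuous:
  fixes f :: "'a \<Rightarrow> 'b::{banach,second_countable_topology}"
  assumes "continuous_on UNIV f"
  shows "integrable \<pi> (\<lambda>p. f (fst p))" "integrable \<pi> (\<lambda>p. f (snd p))"
  using assms
  by (auto intro!: P.integrable_continuous continuous_on_compose2[OF assms] continuous_intros)

lemma abs_tilted_mass_diff_le:
  "\<bar>tilted_mass \<nu> u - tilted_mass \<mu> u\<bar>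
    \<le> exp (norm u * R) * norm u * (\<integral>p. dist (fst p) (snd p) \<partial>\<pi>)"
proof -
  have integrable: "integrable \<pi> (\<lambda>p. exp (u \<bullet> fst p))" "integrable \<pi> (\<lambda>p. exp (u \<bullet> snd p))"
    by (intro integrable_coupling_continuous continuous_intros)+
  have "tilted_mass \<nu> u - tilted_mass \<mu> u = (\<integral>p. exp (u \<bullet> snd p) - exp (u \<bullet> fst p) \<partial>\<pi>)"
    using integrable
    by (simp add: tilted_mass_def integral_fst_coupling integral_snd_coupling integral_diff)
  also have "\<bar>\<dots>\<bar> \<le> exp (norm u * R) * norm u * (\<integral>p. dist (fst p) (snd p) \<partial>\<pi>)"
  proof -
    have "AE p in \<pi>. norm (exp (u \<bullet> snd p) - exp (u \<bullet> fst p))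
        \<le> exp (norm u * R) * norm u * dist (fst p) (snd p)"
      using AE_norm_fst_le AE_norm_snd_le
    proof eventually_elim
      case (elim p)
      show ?case using abs_exp_inner_diff_le[OF elim(2,1), of u]
        by (simp add: dist_norm norm_minus_commute mult.assoc)
    qed
    from norm_integral_le_mean_dist[OF Bochner_Integration.integrable_diff[OF integrable(2,1)] this]
    show ?thesis by simp
  qed
  finally show ?thesis .
qed

lemma tilted_mean_coupling_diff_eq:
  "tilted_mass \<mu> u *\<^sub>R (tilted_mean \<mu> u - tilted_mean \<nu> u)
    = (\<integral>p. exp (u \<bullet> fst p) *\<^sub>R (fst p - snd p) \<partial>\<pi>)
      + (\<integral>p. (exp (u \<bullet> fst p) - exp (u \<bullet> snd p)) *\<^sub>R snd p \<partial>\<pi>)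
      + (tilted_mass \<nu> u - tilted_mass \<mu> u) *\<^sub>R tilted_mean \<nu> u"
proof -
  have borel: "(\<lambda>z. exp (u \<bullet> z)) \<in> borel_measurable borel"
      "(\<lambda>z. exp (u \<bullet> z) *\<^sub>R z) \<in> borel_measurable borel"
    by (intro borel_measurable_continuous_onI continuous_intros)+
  have integrable: "integrable \<pi> (\<lambda>p. exp (u \<bullet> fst p) *\<^sub>R fst p)"
      "integrable \<pi> (\<lambda>p. exp (u \<bullet> snd p) *\<^sub>R snd p)" "integrable \<pi> (\<lambda>p. exp (u \<bullet> fst p) *\<^sub>R snd p)"
    by (intro P.integrable_continuous continuous_intros)+
  have "(\<integral>p. exp (u \<bullet> fst p) *\<^sub>R (fst p - snd p) \<partial>\<pi>)
      + (\<integral>p. (exp (u \<bullet> fst p) - exp (u \<bullet> snd p)) *\<^sub>R snd p \<partial>\<pi>)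
      = (\<integral>p. exp (u \<bullet> fst p) *\<^sub>R fst p \<partial>\<pi>) - (\<integral>p. exp (u \<bullet> snd p) *\<^sub>R snd p \<partial>\<pi>)"
    using integrable by (simp add: scaleR_diff_right scaleR_diff_left integral_diff)
  also have "\<dots> = tilted_mass \<mu> u *\<^sub>R tilted_mean \<mu> u - tilted_mass \<nu> u *\<^sub>R tilted_mean \<nu> u"
    using borel
    by (simp add: integral_fst_coupling integral_snd_coupling
        flip: M1.integral_exp_inner_scaleR M2.integral_exp_inner_scaleR)
  finally show ?thesis by (simp add: algebra_simps)
qed

lemma norm_integral_exp_inner_transport_le:
  "norm (\<integral>p. exp (u \<bullet> fst p) *\<^sub>R (fst p - snd p) \<partial>\<pi>)
    \<le> exp (norm u * R) * (\<integral>p. dist (fst p) (snd p) \<partial>\<pi>)"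
proof (rule norm_integral_le_mean_dist)
  show "integrable \<pi> (\<lambda>p. exp (u \<bullet> fst p) *\<^sub>R (fst p - snd p))"
    by (intro P.integrable_continuous continuous_intros)
  show "AE p in \<pi>. norm (exp (u \<bullet> fst p) *\<^sub>R (fst p - snd p)) \<le> exp (norm u * R) * dist (fst p) (snd p)"
    using AE_norm_fst_le
    by eventually_elim (use exp_inner_le in \<open>auto simp: dist_norm intro!: mult_right_mono\<close>)
qed

lemma norm_integral_exp_inner_reweight_le:
  "norm (\<integral>p. (exp (u \<bullet> fst p) - exp (u \<bullet> snd p)) *\<^sub>R snd p \<partial>\<pi>)
    \<le> exp (norm u * R) * (norm u * R) * (\<integral>p. dist (fst p) (snd p) \<partial>\<pi>)"
proof (rule norm_integral_le_mean_dist)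
  show "integrable \<pi> (\<lambda>p. (exp (u \<bullet> fst p) - exp (u \<bullet> snd p)) *\<^sub>R snd p)"
    by (intro P.integrable_continuous continuous_intros)
  show "AE p in \<pi>. norm ((exp (u \<bullet> fst p) - exp (u \<bullet> snd p)) *\<^sub>R snd p)
      \<le> exp (norm u * R) * (norm u * R) * dist (fst p) (snd p)"
    using AE_norm_fst_le AE_norm_snd_le
  proof eventually_elim
    case (elim p)
    have "\<bar>exp (u \<bullet> fst p) - exp (u \<bullet> snd p)\<bar> * norm (snd p)
        \<le> exp (norm u * R) * (norm u * dist (fst p) (snd p)) * R"
      using abs_exp_inner_diff_le[OF elim, of u] elim(2) by (intro mult_mono) (auto simp: dist_norm)
    then show ?case by (simp add: mult_ac)
  qed
qed

lemma tilted_mass_mult_norm_tilted_mean_coupling_diff_le: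
  "tilted_mass \<mu> u * norm (tilted_mean \<mu> u - tilted_mean \<nu> u)
    \<le> exp (norm u * R) * (1 + 2 * norm u * R) * (\<integral>p. dist (fst p) (snd p) \<partial>\<pi>)"
proof -
  define E where "E = exp (norm u * R)"
  define D where "D = (\<integral>p. dist (fst p) (snd p) \<partial>\<pi>)"
  have renormalize: "\<bar>tilted_mass \<nu> u - tilted_mass \<mu> u\<bar> * norm (tilted_mean \<nu> u) \<le> E * norm u * D * R"
    using abs_tilted_mass_diff_le[of u] M2.norm_tilted_mean_le[of u] M2.radius_nonneg
    unfolding E_def D_def by (intro mult_mono) auto
  have "tilted_mass \<mu> u * norm (tilted_mean \<mu> u - tilted_mean \<nu> u)
      = norm (tilted_mass \<mu> u *\<^sub>R (tilted_mean \<mu> u - tilted_mean \<nu> u))"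
    using M1.tilted_mass_pos[of u] by simp
  also have "\<dots> \<le> E * D + E * (norm u * R) * D + E * norm u * D * R"
    unfolding tilted_mean_coupling_diff_eq
    using norm_integral_exp_inner_transport_le[of u] norm_integral_exp_inner_reweight_le[of u] renormalize
    unfolding E_def D_def
    by (intro order_trans[OF norm_triangle_ineq add_mono] order_trans[OF norm_triangle_ineq]) auto
  also have "\<dots> = E * (1 + 2 * norm u * R) * D" by (simp add: algebra_simps)
  finally show ?thesis by (simp add: E_def D_def)
qed

lemma norm_tilted_mean_coupling_diff_le:
  "norm (tilted_mean \<mu> u - tilted_mean \<nu> u)
    \<le> exp (2 * norm u * R) * (1 + 2 * norm u * R) * (\<integral>p. dist (fst p) (snd p) \<partial>\<pi>)"
proof -
  define C where "C = exp (norm u * R) * (1 + 2 * norm u * R) * (\<integral>p. dist (fst p) (snd p) \<partial>\<pi>)"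
  have "norm (tilted_mean \<mu> u - tilted_mean \<nu> u) \<le> C / tilted_mass \<mu> u"
    using tilted_mass_mult_norm_tilted_mean_coupling_diff_le[of u] M1.tilted_mass_pos[of u]
    by (simp add: C_def field_simps)
  also have "\<dots> \<le> C / exp (- (norm u * R))"
    using M1.tilted_mass_ge[of u] M1.tilted_mass_pos[of u] M1.radius_nonneg unfolding C_def
    by (intro divide_left_mono mult_nonneg_nonneg) auto
  also have "\<dots> = exp (2 * norm u * R) * (1 + 2 * norm u * R) * (\<integral>p. dist (fst p) (snd p) \<partial>\<pi>)"
  proof -
    have "exp (2 * norm u * R) = exp (norm u * R) * exp (norm u * R)"
      unfolding exp_add[symmetric] by (simp add: algebra_simps)
    then show ?thesis by (simp add: C_def exp_minus divide_inverse mult_ac)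
  qed
  finally show ?thesis .
qed

end

lemma norm_tilted_mean_coupling_matrix_le:
  fixes A :: "real^'n^'m" and \<mu> \<nu> :: "(real^'m) measure"
  assumes "ball_coupling \<mu> \<nu> R \<pi>" "norm y \<le> R"
  shows "norm (tilted_mean \<mu> (A *v y) - tilted_mean \<nu> (A *v y))
    \<le> exp (2 * onorm ((*v) A) * R\<^sup>2) * (1 + 2 * onorm ((*v) A) * R\<^sup>2) * (\<integral>p. dist (fst p) (snd p) \<partial>\<pi>)"
proof -
  interpret ball_coupling \<mu> \<nu> R \<pi> by (fact assms(1))
  define a where "a = onorm ((*v) A)"
  have "norm (A *v y) * R \<le> (a * norm y) * R"
    using onorm[OF matrix_vector_mul_bounded_linear, of A y] M1.radius_nonneg
    unfolding a_def by (rule mult_right_mono)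
  also have "\<dots> \<le> (a * R) * R"
    using assms(2) onorm_pos_le[OF matrix_vector_mul_bounded_linear, of A] M1.radius_nonneg
    unfolding a_def by (intro mult_right_mono mult_left_mono)
  finally have "2 * norm (A *v y) * R \<le> 2 * a * R\<^sup>2" by (simp add: power2_eq_square mult_ac)
  then have "exp (2 * norm (A *v y) * R) * (1 + 2 * norm (A *v y) * R) * (\<integral>p. dist (fst p) (snd p) \<partial>\<pi>)
      \<le> exp (2 * a * R\<^sup>2) * (1 + 2 * a * R\<^sup>2) * (\<integral>p. dist (fst p) (snd p) \<partial>\<pi>)"
    using M1.radius_nonneg by (intro mult_right_mono[OF mult_mono]) auto
  then show ?thesis
    using norm_tilted_mean_coupling_diff_le[of "A *v y"] unfolding a_def by linarith
qed

lemma dist_Gamma_le: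
  fixes A :: "real^'d^'d" and V :: "real^'d^'k"
  assumes "ball_coupling \<mu> \<nu> R \<pi>" "norm x \<le> R" "norm y \<le> R"
  defines "a \<equiv> onorm ((*v) A)"
  shows "dist (Gamma A V \<mu> x) (Gamma A V \<nu> y) \<le> onorm ((*v) V) * exp (2 * a * R\<^sup>2)
    * (a * R\<^sup>2 * dist x y + (1 + 2 * a * R\<^sup>2) * (\<integral>p. dist (fst p) (snd p) \<partial>\<pi>))"
proof -
  interpret ball_coupling \<mu> \<nu> R \<pi> by (fact assms(1))
  have "dist (Gamma A V \<mu> x) (Gamma A V \<nu> y)
      = norm (V *v (tilted_mean \<mu> (A *v x) - tilted_mean \<nu> (A *v y)))"
    by (simp add: dist_norm Gamma_eq_tilted_mean[OF M1.ball_prob_space_axioms]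
        Gamma_eq_tilted_mean[OF M2.ball_prob_space_axioms] matrix_vector_mult_diff_distrib)
  also have "\<dots> \<le> onorm ((*v) V) * norm (tilted_mean \<mu> (A *v x) - tilted_mean \<nu> (A *v y))"
    by (rule onorm[OF matrix_vector_mul_bounded_linear])
  also have "\<dots> \<le> onorm ((*v) V) * (exp (2 * a * R\<^sup>2) * (a * R\<^sup>2) * dist x y
      + exp (2 * a * R\<^sup>2) * (1 + 2 * a * R\<^sup>2) * (\<integral>p. dist (fst p) (snd p) \<partial>\<pi>))"
    using norm_diff_triangle_le[OF
        norm_tilted_mean_matrix_diff_le[OF M1.ball_prob_space_axioms assms(2,3)]
        norm_tilted_mean_coupling_matrix_le[OF assms(1,3)]]
    unfolding a_def by (intro mult_left_mono onorm_pos_le[OF matrix_vector_mul_bounded_linear]) simp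
  finally show ?thesis by (simp add: algebra_simps)
qed

lemma ennreal_mult_INF:
  fixes c :: ennreal
  assumes "c \<noteq> \<top>" "A \<noteq> {}"
  shows "c * (INF x\<in>A. f x) = (INF x\<in>A. c * f x)"
proof -
  have "c * Inf (f ` A) = Inf ((*) c ` f ` A)"
  proof (rule continuous_at_Inf_mono)
    show "mono ((*) c)" by (auto simp: mono_def mult_left_mono)
    show "continuous (at_right (Inf (f ` A))) ((*) c)"
      using ennreal_continuous_on_cmult[of c UNIV "\<lambda>x. x"] assms(1)
      by (simp add: top.not_eq_extremum continuous_on_eq_continuous_within
          continuous_at_imp_continuous_within)
  qed (use assms in auto)
  then show ?thesis by (simp add: image_image)
qed

definition quadratic_cost :: "('a::euclidean_space \<times> 'a) measure \<Rightarrow> ennreal" where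
  "quadratic_cost \<pi> = (\<integral>\<^sup>+p. ennreal ((dist (fst p) (snd p))\<^sup>2) \<partial>\<pi>)"

lemma W2_le_if_quadratic_cost_le:
  fixes \<mu> \<nu> :: "'a::euclidean_space measure" and \<mu>' \<nu>' :: "'b::euclidean_space measure"
  assumes "0 \<le> L" "\<pi>\<^sub>0 \<in> couplings \<mu> \<nu>" "quadratic_cost \<pi>\<^sub>0 \<noteq> \<top>"
    and "\<And>\<pi>. \<pi> \<in> couplings \<mu> \<nu> \<Longrightarrow>
      \<exists>\<pi>'\<in>couplings \<mu>' \<nu>'. quadratic_cost \<pi>' \<le> ennreal (L\<^sup>2) * quadratic_cost \<pi>"
  shows "W2 \<mu>' \<nu>' \<le> L * W2 \<mu> \<nu>"
proof -
  define I where "I = (INF \<pi>\<in>couplings \<mu> \<nu>. quadratic_cost \<pi>)"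
  define I' where "I' = (INF \<pi>\<in>couplings \<mu>' \<nu>'. quadratic_cost \<pi>)"
  have "I' \<le> (INF \<pi>\<in>couplings \<mu> \<nu>. ennreal (L\<^sup>2) * quadratic_cost \<pi>)"
    unfolding I'_def using assms(4) by (intro INF_greatest) (meson INF_lower2)
  also have "\<dots> = ennreal (L\<^sup>2) * I"
    unfolding I_def using assms(2) by (intro ennreal_mult_INF[symmetric]) auto
  finally have "enn2real I' \<le> enn2real (ennreal (L\<^sup>2) * I)"
  proof (rule enn2real_mono)
    have "I \<le> quadratic_cost \<pi>\<^sub>0" unfolding I_def using assms(2) by (rule INF_lower)
    then show "ennreal (L\<^sup>2) * I < \<top>"
      using assms(3) by (simp add: ennreal_mult_less_top top.not_eq_extremum le_less_trans)
  qed
  then have "sqrt (enn2real I') \<le> sqrt (L\<^sup>2 * enn2real I)" by (simp add: enn2real_mult)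
  then show ?thesis
    using assms(1) by (simp add: W2_def quadratic_cost_def I_def I'_def real_sqrt_mult)
qed

lemma measurable_map_prod_coupling:
  fixes f :: "'a::euclidean_space \<Rightarrow> 'b::euclidean_space" and g :: "'a \<Rightarrow> 'b"
  assumes "\<pi> \<in> couplings \<mu> \<nu>" "f \<in> borel_measurable borel" "g \<in> borel_measurable borel"
  shows "map_prod f g \<in> measurable \<pi> (borel \<Otimes>\<^sub>M borel)"
proof -
  have "sets \<pi> = sets (borel \<Otimes>\<^sub>M borel)" using assms(1) by (simp add: couplings_def)
  then have "fst \<in> measurable \<pi> borel" "snd \<in> measurable \<pi> borel"
    using measurable_cong_sets[OF _ refl] by auto
  then show ?thesis
    unfolding map_prod_def split_beta'
    by (intro measurable_Pair measurable_compose[OF _ assms(2)] measurable_compose[OF _ assms(3)])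
qed

lemma distr_map_prod_in_couplings:
  fixes f :: "'a::euclidean_space \<Rightarrow> 'b::euclidean_space" and g :: "'a \<Rightarrow> 'b"
  assumes \<pi>: "\<pi> \<in> couplings \<mu> \<nu>"
    and f: "f \<in> borel_measurable borel" and g: "g \<in> borel_measurable borel"
  shows "distr \<pi> (borel \<Otimes>\<^sub>M borel) (map_prod f g) \<in> couplings (distr \<mu> borel f) (distr \<nu> borel g)"
proof -
  have fst: "fst \<in> measurable \<pi> borel" and snd: "snd \<in> measurable \<pi> borel"
    using \<pi> measurable_cong_sets[OF _ refl] by (auto simp: couplings_def)
  have map: "map_prod f g \<in> measurable \<pi> (borel \<Otimes>\<^sub>M borel)"
    by (rule measurable_map_prod_coupling[OF assms])
  have "distr (distr \<pi> (borel \<Otimes>\<^sub>M borel) (map_prod f g)) borel fst = distr \<pi> borel (f \<circ> fst)"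
    by (simp add: distr_distr[OF measurable_fst map] comp_def)
  also have "\<dots> = distr \<mu> borel f"
    using \<pi> by (simp add: distr_distr[OF f fst, symmetric] couplings_def)
  finally have "distr (distr \<pi> (borel \<Otimes>\<^sub>M borel) (map_prod f g)) borel fst = distr \<mu> borel f" .
  moreover have "distr (distr \<pi> (borel \<Otimes>\<^sub>M borel) (map_prod f g)) borel snd = distr \<pi> borel (g \<circ> snd)"
    by (simp add: distr_distr[OF measurable_snd map] comp_def)
  moreover have "\<dots> = distr \<nu> borel g"
    using \<pi> by (simp add: distr_distr[OF g snd, symmetric] couplings_def)
  ultimately show ?thesis
    using \<pi> map by (auto simp: couplings_def intro: prob_space.prob_space_distr)
qed

lemma pair_measure_in_couplings:
  fixes \<mu> \<nu> :: "'a::euclidean_space measure"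
  assumes "prob_space \<mu>" "prob_space \<nu>" "sets \<mu> = sets borel" "sets \<nu> = sets borel"
  shows "\<mu> \<Otimes>\<^sub>M \<nu> \<in> couplings \<mu> \<nu>"
proof -
  interpret pair_prob_space \<mu> \<nu>
    using assms by (simp add: pair_prob_space_def pair_sigma_finite_def prob_space_imp_sigma_finite)
  have "distr (\<mu> \<Otimes>\<^sub>M \<nu>) borel fst = \<mu>"
    using M2.distr_pair_fst assms(3) by (metis distr_cong sets_eq_imp_space_eq)
  moreover have "distr (\<mu> \<Otimes>\<^sub>M \<nu>) borel snd = \<nu>"
  proof -
    have "distr (\<mu> \<Otimes>\<^sub>M \<nu>) borel snd
        = distr (distr (\<nu> \<Otimes>\<^sub>M \<mu>) (\<mu> \<Otimes>\<^sub>M \<nu>) (\<lambda>(x, y). (y, x))) borel snd"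
      by (simp flip: distr_pair_swap)
    also have "\<dots> = distr (\<nu> \<Otimes>\<^sub>M \<mu>) borel fst"
      using assms(3,4)
      by (subst distr_distr) (auto simp: comp_def split_beta' measurable_pair_swap' cong: distr_cong
          intro: measurable_cong_sets)
    also have "\<dots> = \<nu>"
      using M1.distr_pair_fst[of \<nu>] assms(4) by (metis distr_cong sets_eq_imp_space_eq)
    finally show ?thesis .
  qed
  ultimately show ?thesis
    using P.prob_space_axioms sets_pair_measure_cong[OF assms(3,4)] by (simp add: couplings_def)
qed

lemma (in prob_space) integral_square_affine_mean_le:
  fixes f :: "'a \<Rightarrow> real"
  assumes "integrable M f" "integrable M (\<lambda>x. (f x)\<^sup>2)" "0 \<le> a" "0 \<le> b"
  shows "(\<integral>x. (a * f x + b * expectation f)\<^sup>2 \<partial>M) \<le> (a + b)\<^sup>2 * expectation (\<lambda>x. (f x)\<^sup>2)"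
proof -
  define m where "m = expectation f"
  define S where "S = expectation (\<lambda>x. (f x)\<^sup>2)"
  have Jensen: "m\<^sup>2 \<le> S"
    using variance_eq[OF assms(1,2)] variance_positive[of f] by (simp add: m_def S_def)
  have "(\<integral>x. (a * f x + b * m)\<^sup>2 \<partial>M) = a\<^sup>2 * S + 2 * a * b * m\<^sup>2 + b\<^sup>2 * m\<^sup>2"
  proof -
    have "(\<lambda>x. (a * f x + b * m)\<^sup>2) = (\<lambda>x. a\<^sup>2 * (f x)\<^sup>2 + (2 * a * b * m) * f x + b\<^sup>2 * m\<^sup>2)"
      by (simp add: power2_eq_square algebra_simps)
    then show ?thesis
      using assms(1,2) by (simp add: S_def m_def prob_space power2_eq_square)
  qed
  also have "\<dots> \<le> a\<^sup>2 * S + 2 * a * b * S + b\<^sup>2 * S"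
    using Jensen assms(3,4) by (intro add_mono mult_left_mono) auto
  also have "\<dots> = (a + b)\<^sup>2 * S" by (simp add: power2_eq_square algebra_simps)
  finally show ?thesis by (simp add: m_def S_def)
qed

lemma (in ball_coupling) quadratic_cost_eq_integral:
  "quadratic_cost \<pi> = ennreal (\<integral>p. (dist (fst p) (snd p))\<^sup>2 \<partial>\<pi>)"
  unfolding quadratic_cost_def
  by (intro nn_integral_eq_integral P.integrable_continuous continuous_intros) auto

lemma borel_measurable_quadratic_cost_integrand:
  "(\<lambda>q::'a::euclidean_space \<times> 'a. ennreal ((dist (fst q) (snd q))\<^sup>2)) \<in> borel_measurable (borel \<Otimes>\<^sub>M borel)"
  unfolding borel_prod
  by (intro measurable_compose[OF _ measurable_ennreal] borel_measurable_continuous_onI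
      continuous_intros)

lemma quadratic_cost_distr_map_prod:
  fixes f :: "'a::euclidean_space \<Rightarrow> 'b::euclidean_space" and g :: "'a \<Rightarrow> 'b"
  assumes "\<pi> \<in> couplings \<mu> \<nu>" "f \<in> borel_measurable borel" "g \<in> borel_measurable borel"
  shows "quadratic_cost (distr \<pi> (borel \<Otimes>\<^sub>M borel) (map_prod f g))
    = (\<integral>\<^sup>+p. ennreal ((dist (f (fst p)) (g (snd p)))\<^sup>2) \<partial>\<pi>)"
  unfolding quadratic_cost_def using borel_measurable_quadratic_cost_integrand
  by (subst nn_integral_distr[OF measurable_map_prod_coupling[OF assms]]) simp_all

lemma SA_coupling_in_couplings:
  assumes "ball_coupling \<mu> \<nu> R \<pi>"
  shows "distr \<pi> (borel \<Otimes>\<^sub>M borel) (map_prod (Gamma A V \<mu>) (Gamma A V \<nu>))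
    \<in> couplings (SA A V \<mu>) (SA A V \<nu>)"
  unfolding SA_def
  using assms ball_coupling.coupling ball_coupling_def continuous_on_Gamma
  by (metis distr_map_prod_in_couplings borel_measurable_continuous_onI)

lemma quadratic_cost_SA_coupling_le:
  fixes A :: "real^'d^'d" and V :: "real^'d^'k"
  assumes "ball_coupling \<mu> \<nu> R \<pi>"
  defines "L \<equiv> onorm ((*v) V) * (1 + 3 * onorm ((*v) A) * R\<^sup>2) * exp (2 * onorm ((*v) A) * R\<^sup>2)"
  shows "quadratic_cost (distr \<pi> (borel \<Otimes>\<^sub>M borel) (map_prod (Gamma A V \<mu>) (Gamma A V \<nu>)))
    \<le> ennreal (L\<^sup>2) * quadratic_cost \<pi>"
proof -
  interpret ball_coupling \<mu> \<nu> R \<pi> by (fact assms(1))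
  define a where "a = onorm ((*v) A)"
  define K where "K = onorm ((*v) V) * exp (2 * a * R\<^sup>2)"
  define d where "d = (\<lambda>p::(real^'d) \<times> (real^'d). dist (fst p) (snd p))"
  have a_nonneg: "0 \<le> a" unfolding a_def by (rule onorm_pos_le[OF matrix_vector_mul_bounded_linear])
  have integrable: "integrable \<pi> d" "integrable \<pi> (\<lambda>p. (d p)\<^sup>2)"
    unfolding d_def by (intro P.integrable_continuous continuous_intros)+
  have borel: "Gamma A V \<mu> \<in> borel_measurable borel" "Gamma A V \<nu> \<in> borel_measurable borel"
    by (rule borel_measurable_continuous_onI[OF continuous_on_Gamma[OF M1.ball_prob_space_axioms]]
        borel_measurable_continuous_onI[OF continuous_on_Gamma[OF M2.ball_prob_space_axioms]])+
  have "quadratic_cost (distr \<pi> (borel \<Otimes>\<^sub>M borel) (map_prod (Gamma A V \<mu>) (Gamma A V \<nu>)))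
      = (\<integral>\<^sup>+p. ennreal ((dist (Gamma A V \<mu> (fst p)) (Gamma A V \<nu> (snd p)))\<^sup>2) \<partial>\<pi>)"
    by (rule quadratic_cost_distr_map_prod[OF coupling borel])
  also have "\<dots> \<le> (\<integral>\<^sup>+p. ennreal ((K * (a * R\<^sup>2 * d p + (1 + 2 * a * R\<^sup>2) * P.expectation d))\<^sup>2) \<partial>\<pi>)"
  proof (rule nn_integral_mono_AE)
    show "AE p in \<pi>. ennreal ((dist (Gamma A V \<mu> (fst p)) (Gamma A V \<nu> (snd p)))\<^sup>2)
        \<le> ennreal ((K * (a * R\<^sup>2 * d p + (1 + 2 * a * R\<^sup>2) * P.expectation d))\<^sup>2)"
      using AE_norm_fst_le AE_norm_snd_le
      by eventually_elim (use dist_Gamma_le[OF assms(1)] in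
          \<open>auto simp: K_def a_def d_def mult.assoc intro!: ennreal_leI power_mono\<close>)
  qed
  also have "\<dots> = ennreal (\<integral>p. (K * (a * R\<^sup>2 * d p + (1 + 2 * a * R\<^sup>2) * P.expectation d))\<^sup>2 \<partial>\<pi>)"
    by (rule nn_integral_eq_integral) (auto simp: d_def intro!: P.integrable_continuous continuous_intros)
  also have "\<dots> = ennreal (K\<^sup>2 * (\<integral>p. (a * R\<^sup>2 * d p + (1 + 2 * a * R\<^sup>2) * P.expectation d)\<^sup>2 \<partial>\<pi>))"
    by (simp add: power_mult_distrib)
  also have "\<dots> \<le> ennreal (K\<^sup>2 * ((1 + 3 * a * R\<^sup>2)\<^sup>2 * (\<integral>p. (d p)\<^sup>2 \<partial>\<pi>)))"
    using P.integral_square_affine_mean_le[OF integrable, of "a * R\<^sup>2" "1 + 2 * a * R\<^sup>2"] a_nonneg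
    by (intro ennreal_leI mult_left_mono) (auto simp: algebra_simps)
  also have "\<dots> = ennreal (L\<^sup>2) * quadratic_cost \<pi>"
    by (simp add: quadratic_cost_eq_integral d_def L_def K_def a_def ennreal_mult power_mult_distrib
        mult_ac)
  finally show ?thesis .
qed

lemma ball_coupling_if_couplings:
  "\<mu> \<in> prob_ball R \<Longrightarrow> \<nu> \<in> prob_ball R \<Longrightarrow> \<pi> \<in> couplings \<mu> \<nu> \<Longrightarrow> ball_coupling \<mu> \<nu> R \<pi>"
  by (simp add: ball_coupling_def ball_coupling_axioms_def ball_prob_space_if_prob_ball)

lemma W2_SA_le:
  fixes A :: "real^'d^'d" and V :: "real^'d^'k" and \<mu> \<nu> :: "(real^'d) measure"
  assumes \<mu>: "\<mu> \<in> prob_ball R" and \<nu>: "\<nu> \<in> prob_ball R"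
  defines "L \<equiv> onorm ((*v) V) * (1 + 3 * onorm ((*v) A) * R\<^sup>2) * exp (2 * onorm ((*v) A) * R\<^sup>2)"
  shows "W2 (SA A V \<mu>) (SA A V \<nu>) \<le> L * W2 \<mu> \<nu>"
proof (rule W2_le_if_quadratic_cost_le)
  show "0 \<le> L" unfolding L_def by (simp add: onorm_pos_le[OF matrix_vector_mul_bounded_linear])
  show product: "\<mu> \<Otimes>\<^sub>M \<nu> \<in> couplings \<mu> \<nu>"
    using \<mu> \<nu> unfolding prob_ball_def by (intro pair_measure_in_couplings) auto
  show "quadratic_cost (\<mu> \<Otimes>\<^sub>M \<nu>) \<noteq> \<top>"
    using ball_coupling.quadratic_cost_eq_integral[OF ball_coupling_if_couplings[OF \<mu> \<nu> product]]
    by simp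
next
  fix \<pi> assume "\<pi> \<in> couplings \<mu> \<nu>"
  then have "ball_coupling \<mu> \<nu> R \<pi>" by (rule ball_coupling_if_couplings[OF \<mu> \<nu>])
  then show "\<exists>\<pi>'\<in>couplings (SA A V \<mu>) (SA A V \<nu>). quadratic_cost \<pi>' \<le> ennreal (L\<^sup>2) * quadratic_cost \<pi>"
    unfolding L_def by (blast intro: SA_coupling_in_couplings quadratic_cost_SA_coupling_le)
qed

theorem mainTheorem4:
  fixes Q K V :: "real^'d^'k" and R :: real
  assumes "R > 0"
  defines "A \<equiv> (1 / sqrt (real CARD('k))) *\<^sub>R (transpose K ** Q)"
  shows "\<forall>\<mu>\<in>prob_ball R. \<forall>\<nu>\<in>prob_ball R.
           W2 (SA A V \<mu>) (SA A V \<nu>)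
             \<le> onorm ((*v) V) * (1 + 3 * onorm ((*v) A) * R\<^sup>2) * exp (2 * onorm ((*v) A) * R\<^sup>2)
                 * W2 \<mu> \<nu>"
  by (intro ballI W2_SA_le)

end
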